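(* (1) $\mathrm{Tack}_2$ equals the least normal bimodal logic containing the commutator $[\mathrm{S4}[2],\mathrm{S5}]$ and the formulas $\lozenge_1\lozenge_2\Box_1\Box_2p\to\Box_1\Box_2\lozenge_1\lozenge_2p$, $\Box_1\Box_2\lozenge_1\lozenge_2p\to\lozenge_1\lozenge_2\Box_1\Box_2p$, and $\lozenge_1\Box_1q\wedge\neg q\wedge p\to\Box_1(\neg q\to\lozenge_1p)$. (2) $\mathrm{Tack}_2$ is canonical.
   Context: For sets $X,Y$, let $\mathrm{T}(X,Y)$ be the bimodal frame with domain $(X\times Y)\cup\{t\}$ ($t$ a new point), $R_1=\{((a,b),(a',b))\}\cup((X\times Y)\times\{t\})\cup\{(t,t)\}$ and $R_2=\{((a,b),(a,b'))\}\cup\{(t,t)\}$ (ranging over $a,a'\in X$, $b,b'\in Y$); $R_i$ interprets $\lozenge_i$. $\mathrm{Tack}_2$ is the logic of $\mathrm{T}(\omega,\omega)$. $\mathrm{S4}$ is the least normal unimodal logic containing $\lozenge\lozenge p\to\lozenge p$ and $p\to\lozenge p$; $\mathrm{S5}$ extends it by $p\to\Box\lozenge p$. With $B_0=\bot$, $B_{i+1}=p_{i+1}\to\Box(\lozenge p_{i+1}\vee B_i)$, $\mathrm{S4}[2]$ is $\mathrm{S4}$ plus $B_2$. The commutator $[L_1,L_2]$ of unimodal logics is the least normal bimodal logic containing $L_1$ in $\lozenge_1$, $L_2$ in $\lozenge_2$, and $\lozenge_1\lozenge_2p\to\lozenge_2\lozenge_1p$, $\lozenge_2\lozenge_1p\to\lozenge_1\lozenge_2p$,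 $\lozenge_1\Box_2p\to\Box_2\lozenge_1p$. A normal logic is canonical if it is valid in its canonical frame. *)

theory Defs
  imports Main
begin

datatype 'm fm =
    Var nat
  | Bot
  | Imp "'m fm" "'m fm"
  | Dia 'm "'m fm"

abbreviation Neg :: "'m fm \<Rightarrow> 'm fm" where "Neg \<phi> \<equiv> Imp \<phi> Bot"
abbreviation Top :: "'m fm" where "Top \<equiv> Neg Bot"
abbreviation Or :: "'m fm \<Rightarrow> 'm fm \<Rightarrow> 'm fm" where "Or \<phi> \<psi> \<equiv> Imp (Neg \<phi>) \<psi>"
abbreviation And :: "'m fm \<Rightarrow> 'm fm \<Rightarrow> 'm fm" where "And \<phi> \<psi> \<equiv> Neg (Imp \<phi> (Neg \<psi>))"
abbreviation Box :: "'m \<Rightarrow> 'm fm \<Rightarrow> 'm fm" where "Box i \<phi> \<equiv> Neg (Dia i (Neg \<phi>))"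

fun Conj :: "'m fm list \<Rightarrow> 'm fm" where
  "Conj [] = Top"
| "Conj (\<phi> # \<phi>s) = And \<phi> (Conj \<phi>s)"

primrec subst :: "(nat \<Rightarrow> 'm fm) \<Rightarrow> 'm fm \<Rightarrow> 'm fm" where
  "subst \<sigma> (Var n) = \<sigma> n"
| "subst \<sigma> Bot = Bot"
| "subst \<sigma> (Imp \<phi> \<psi>) = Imp (subst \<sigma> \<phi>) (subst \<sigma> \<psi>)"
| "subst \<sigma> (Dia i \<phi>) = Dia i (subst \<sigma> \<phi>)"

text \<open>Classical evaluation; variables and diamond formulas both count as propositional atoms.\<close>

fun prop_eval :: "('m fm \<Rightarrow> bool) \<Rightarrow> 'm fm \<Rightarrow> bool" where
  "prop_eval v Bot = False"
| "prop_eval v (Imp \<phi> \<psi>) = (prop_eval v \<phi> \<longrightarrow> prop_eval v \<psi>)"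
| "prop_eval v \<phi> = v \<phi>"

definition tautology :: "'m fm \<Rightarrow> bool" where
  "tautology \<phi> \<longleftrightarrow> (\<forall>v. prop_eval v \<phi>)"

text \<open>
  Since diamond is primitive and box abbreviates its dual, normality is expressed by the diamond
  axioms and monotonicity. The axiom K and necessitation for box alone would not
  identify \<open>Dia i \<phi>\<close> with \<open>Dia i (Neg (Neg \<phi>))\<close>.
\<close>

locale normal_logic =
  fixes L :: "'m fm set"
  assumes taut: "tautology \<phi> \<Longrightarrow> \<phi> \<in> L"
    and dia_bot: "Neg (Dia i Bot) \<in> L"
    and dia_or: "Imp (Dia i (Or (Var 0) (Var 1))) (Or (Dia i (Var 0)) (Dia i (Var 1))) \<in> L"
    and modus_ponens: "\<phi> \<in> L \<Longrightarrow> Imp \<phi> \<psi> \<in> L \<Longrightarrow> \<psi> \<in> L"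
    and substitution: "\<phi> \<in> L \<Longrightarrow> subst \<sigma> \<phi> \<in> L"
    and monotonicity: "Imp \<phi> \<psi> \<in> L \<Longrightarrow> Imp (Dia i \<phi>) (Dia i \<psi>) \<in> L"

definition least_normal :: "'m fm set \<Rightarrow> 'm fm set" where
  "least_normal \<Gamma> = \<Inter> {L. normal_logic L \<and> \<Gamma> \<subseteq> L}"

lemma in_least_normal:
  "\<phi> \<in> least_normal \<Gamma> \<longleftrightarrow> (\<forall>L. normal_logic L \<longrightarrow> \<Gamma> \<subseteq> L \<longrightarrow> \<phi> \<in> L)"
  unfolding least_normal_def by blast

lemma least_normal_normal: "normal_logic (least_normal \<Gamma>)"
proof (rule normal_logic.intro; unfold in_least_normal; intro allI impI)
  fix L \<phi> \<psi>
  assume "\<forall>L. normal_logic L \<longrightarrow> \<Gamma> \<subseteq> L \<longrightarrow> \<phi> \<in> L"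
    "\<forall>L. normal_logic L \<longrightarrow> \<Gamma> \<subseteq> L \<longrightarrow> Imp \<phi> \<psi> \<in> L" "normal_logic L" "\<Gamma> \<subseteq> L"
  then show "\<psi> \<in> L" by (meson normal_logic.modus_ponens)
qed (meson normal_logic.taut normal_logic.dia_bot normal_logic.dia_or
      normal_logic.substitution normal_logic.monotonicity)+

lemma least_normal_superset: "\<Gamma> \<subseteq> least_normal \<Gamma>"
  unfolding least_normal_def by blast

lemma least_normal_least: "normal_logic L \<Longrightarrow> \<Gamma> \<subseteq> L \<Longrightarrow> least_normal \<Gamma> \<subseteq> L"
  unfolding least_normal_def by blast

record ('m, 'w) frame =
  worlds :: "'w set"
  rel :: "'m \<Rightarrow> ('w \<times> 'w) set"

primrec sat :: "('m, 'w) frame \<Rightarrow> (nat \<Rightarrow> 'w set) \<Rightarrow> 'w \<Rightarrow> 'm fm \<Rightarrow> bool" where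
  "sat F V w (Var n) \<longleftrightarrow> w \<in> V n"
| "sat F V w Bot \<longleftrightarrow> False"
| "sat F V w (Imp \<phi> \<psi>) \<longleftrightarrow> (sat F V w \<phi> \<longrightarrow> sat F V w \<psi>)"
| "sat F V w (Dia i \<phi>) \<longleftrightarrow> (\<exists>u \<in> worlds F. (w, u) \<in> rel F i \<and> sat F V u \<phi>)"

definition valid :: "('m, 'w) frame \<Rightarrow> 'm fm \<Rightarrow> bool" where
  "valid F \<phi> \<longleftrightarrow> (\<forall>V. \<forall>w \<in> worlds F. sat F V w \<phi>)"

definition logic_of :: "('m, 'w) frame \<Rightarrow> 'm fm set" where
  "logic_of F = {\<phi>. valid F \<phi>}"

definition consistent :: "'m fm set \<Rightarrow> 'm fm set \<Rightarrow> bool" where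
  "consistent L \<Gamma> \<longleftrightarrow> (\<forall>\<phi>s. set \<phi>s \<subseteq> \<Gamma> \<longrightarrow> Neg (Conj \<phi>s) \<notin> L)"

definition max_consistent :: "'m fm set \<Rightarrow> 'm fm set \<Rightarrow> bool" where
  "max_consistent L \<Gamma> \<longleftrightarrow> consistent L \<Gamma> \<and> (\<forall>\<Delta>. \<Gamma> \<subset> \<Delta> \<longrightarrow> \<not> consistent L \<Delta>)"

definition canonical_frame :: "'m fm set \<Rightarrow> ('m, 'm fm set) frame" where
  "canonical_frame L =
     \<lparr>worlds = {\<Gamma>. max_consistent L \<Gamma>},
      rel = (\<lambda>i. {(\<Gamma>, \<Delta>). max_consistent L \<Gamma> \<and> max_consistent L \<Delta> \<and> (\<forall>\<phi> \<in> \<Delta>. Dia i \<phi> \<in> \<Gamma>)})\<rparr>"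

definition canonical :: "'m fm set \<Rightarrow> bool" where
  "canonical L \<longleftrightarrow> (\<forall>\<phi> \<in> L. valid (canonical_frame L) \<phi>)"

text \<open>Unimodal formulas have modality type \<^typ>\<open>unit\<close>.\<close>

definition S4 :: "unit fm set" where
  "S4 = least_normal
     {Imp (Dia () (Dia () (Var 0))) (Dia () (Var 0)),
      Imp (Var 0) (Dia () (Var 0))}"

definition S5 :: "unit fm set" where
  "S5 = least_normal (S4 \<union> {Imp (Var 0) (Box () (Dia () (Var 0)))})"

primrec B_fm :: "nat \<Rightarrow> unit fm" where
  "B_fm 0 = Bot"
| "B_fm (Suc i) = Imp (Var (Suc i)) (Box () (Or (Dia () (Var (Suc i))) (B_fm i)))"

definition S4_B2 :: "unit fm set" where
  "S4_B2 = least_normal (S4 \<union> {B_fm 2})"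

datatype modality = M1 | M2

text \<open>\<open>map_fm (\<lambda>_. i)\<close> reads a unimodal formula in the modality \<open>i\<close>.\<close>

definition commutator :: "unit fm set \<Rightarrow> unit fm set \<Rightarrow> modality fm set" where
  "commutator L1 L2 = least_normal
     (map_fm (\<lambda>_. M1) ` L1 \<union> map_fm (\<lambda>_. M2) ` L2 \<union>
      {Imp (Dia M1 (Dia M2 (Var 0))) (Dia M2 (Dia M1 (Var 0))),
       Imp (Dia M2 (Dia M1 (Var 0))) (Dia M1 (Dia M2 (Var 0))),
       Imp (Dia M1 (Box M2 (Var 0))) (Box M2 (Dia M1 (Var 0)))})"

text \<open>The additional point \<open>t\<close> is \<^term>\<open>None\<close>.\<close>

definition tack_frame :: "'a set \<Rightarrow> 'b set \<Rightarrow> (modality, ('a \<times> 'b) option) frame" where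
  "tack_frame X Y =
     \<lparr>worlds = Some ` (X \<times> Y) \<union> {None},
      rel = (\<lambda>i. case i of
        M1 \<Rightarrow> {(Some (a, b), Some (a', b)) | a a' b. a \<in> X \<and> a' \<in> X \<and> b \<in> Y}
              \<union> (Some ` (X \<times> Y)) \<times> {None} \<union> {(None, None)}
      | M2 \<Rightarrow> {(Some (a, b), Some (a, b')) | a b b'. a \<in> X \<and> b \<in> Y \<and> b' \<in> Y}
              \<union> {(None, None)})\<rparr>"

definition Tack2 :: "modality fm set" where
  "Tack2 = logic_of (tack_frame (UNIV :: nat set) (UNIV :: nat set))"

end

theory Submission
  imports Defs "HOL-Library.Nat_Bijection" "HOL-Library.Countable_Set"
begin

text \<open>
  Let \<open>L\<close> be the axiomatised logic. In the canonical frame of \<open>L\<close> the relations \<open>R\<^sub>1\<close>, \<open>R\<^sub>2\<close> commute,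
  and every point sees a final point \<open>t\<close>, supplied by the two McKinsey-type axioms; symmetry of
  \<open>R\<^sub>2\<close> makes it an \<open>R\<^sub>1\<close>-successor. The last axiom then says that \<open>R\<^sub>1\<close> is symmetric away from
  \<open>t\<close>. So a rooted piece of the frame is \<open>t\<close> on top of two commuting equivalence relations whose
  composition is universal, and a filtration of it is an image of the grid \<open>\<omega> \<times> \<omega>\<close>. Hence the
  logic of the tack \<open>T(\<omega>, \<omega>)\<close> is valid in the canonical frame of \<open>L\<close>, which yields completeness
  and canonicity at once.
\<close>

section \<open>Soundness\<close>

lemma prop_eval_sat: "prop_eval (sat F V w) \<phi> = sat F V w \<phi>"
  by (induction \<phi>) auto

lemma sat_subst: "w \<in> worlds F \<Longrightarrow>
  sat F V w (subst \<sigma> \<phi>) = sat F (\<lambda>n. {u. sat F V u (\<sigma> n)}) w \<phi>"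
  by (induction \<phi> arbitrary: w) auto

lemma normal_logic_of: "normal_logic (logic_of F)"
proof
  fix \<phi> :: "'a fm" assume "tautology \<phi>"
  then have "sat F V w \<phi>" for V w
    by (metis prop_eval_sat tautology_def)
  then show "\<phi> \<in> logic_of F"
    by (simp add: logic_of_def valid_def)
qed (auto simp: logic_of_def valid_def sat_subst)

section \<open>Relabelling modalities\<close>

lemma prop_eval_map_fm: "prop_eval v (map_fm h \<phi>) = prop_eval (\<lambda>\<psi>. v (map_fm h \<psi>)) \<phi>"
  by (induction \<phi>) auto

lemma map_fm_subst: "map_fm h (subst \<sigma> \<phi>) = subst (\<lambda>n. map_fm h (\<sigma> n)) (map_fm h \<phi>)"
  by (induction \<phi>) auto

lemma normal_logic_map_vimage:
  assumes "normal_logic L"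
  shows "normal_logic {\<phi>. map_fm h \<phi> \<in> L}"
proof -
  interpret normal_logic L by fact
  show ?thesis
  proof
    fix \<phi> :: "'b fm" assume "tautology \<phi>"
    then have "tautology (map_fm h \<phi>)"
      by (simp add: tautology_def prop_eval_map_fm)
    then show "\<phi> \<in> {\<phi>. map_fm h \<phi> \<in> L}"
      by (simp add: taut)
  next
    show "\<psi> \<in> {\<phi>. map_fm h \<phi> \<in> L}"
      if "\<phi> \<in> {\<phi>. map_fm h \<phi> \<in> L}" "Imp \<phi> \<psi> \<in> {\<phi>. map_fm h \<phi> \<in> L}" for \<phi> \<psi>
      using that modus_ponens[of "map_fm h \<phi>"] by simp
  qed (simp_all add: dia_bot dia_or[simplified] monotonicity map_fm_subst substitution)
qed

text \<open>The preimage of \<open>L\<close> under a relabelling is again a normal logic, so only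
  the generators have to be checked.\<close>

lemma map_least_normal_subset:
  assumes "normal_logic L" "map_fm h ` \<Gamma> \<subseteq> L"
  shows "map_fm h ` least_normal \<Gamma> \<subseteq> L"
proof -
  have "least_normal \<Gamma> \<subseteq> {\<phi>. map_fm h \<phi> \<in> L}"
    using assms by (intro least_normal_least normal_logic_map_vimage) auto
  then show ?thesis by auto
qed

definition tack_logic :: "modality fm set" where
  "tack_logic = least_normal (commutator S4_B2 S5 \<union>
     {Imp (Dia M1 (Dia M2 (Box M1 (Box M2 (Var 0))))) (Box M1 (Box M2 (Dia M1 (Dia M2 (Var 0))))),
      Imp (Box M1 (Box M2 (Dia M1 (Dia M2 (Var 0))))) (Dia M1 (Dia M2 (Box M1 (Box M2 (Var 0))))),
      Imp (And (And (Dia M1 (Box M1 (Var 1))) (Neg (Var 1))) (Var 0))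
          (Box M1 (Imp (Neg (Var 1)) (Dia M1 (Var 0))))})"

section \<open>Truth in the tack and soundness of the axioms\<close>

lemma tack_frame_simps:
  "worlds (tack_frame UNIV UNIV) = UNIV"
  "(None, u) \<in> rel (tack_frame UNIV UNIV) i \<longleftrightarrow> u = None"
  "(Some (a, b), None) \<in> rel (tack_frame UNIV UNIV) i \<longleftrightarrow> i = M1"
  "(Some (a, b), Some (a', b')) \<in> rel (tack_frame UNIV UNIV) M1 \<longleftrightarrow> b = b'"
  "(Some (a, b), Some (a', b')) \<in> rel (tack_frame UNIV UNIV) M2 \<longleftrightarrow> a = a'"
proof -
  have "x = None \<or> x \<in> range Some" for x :: "('a \<times> 'b) option"
    by (cases x) auto
  then show "worlds (tack_frame UNIV UNIV :: (modality, ('a \<times> 'b) option) frame) = UNIV"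
    by (auto simp: tack_frame_def)
qed (cases i; auto simp: tack_frame_def)+

abbreviation tack_sat ::
  "(nat \<Rightarrow> (nat \<times> nat) option set) \<Rightarrow> (nat \<times> nat) option \<Rightarrow> modality fm \<Rightarrow> bool" where
  "tack_sat \<equiv> sat (tack_frame UNIV UNIV)"

text \<open>With the clauses for \<open>Some\<close>, this replaces the general clause for diamonds,
  which leaves the simpset below. Validity of each axiom then becomes first-order reasoning about
  coordinates.\<close>

lemma sat_tack_None [simp]:
  "tack_sat V None (Dia i \<phi>) \<longleftrightarrow> tack_sat V None \<phi>"
  by (simp add: tack_frame_simps)

lemma sat_tack_Some [simp]:
  "tack_sat V (Some (a, b)) (Dia M1 \<phi>) \<longleftrightarrow>
     tack_sat V None \<phi> \<or>
     (\<exists>a'. tack_sat V (Some (a', b)) \<phi>)"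
  "tack_sat V (Some (a, b)) (Dia M2 \<phi>) \<longleftrightarrow>
     (\<exists>b'. tack_sat V (Some (a, b')) \<phi>)"
  by (simp_all add: tack_frame_simps split_option_ex)

declare sat.simps(4) [simp del]

lemma in_Tack2_iff:
  "\<phi> \<in> Tack2 \<longleftrightarrow> (\<forall>V. tack_sat V None \<phi> \<and>
     (\<forall>a b. tack_sat V (Some (a, b)) \<phi>))"
  unfolding Tack2_def logic_of_def valid_def
  by (auto simp: tack_frame_simps split_option_all)

lemma normal_Tack2: "normal_logic Tack2"
  unfolding Tack2_def by (rule normal_logic_of)

lemma S4_Tack2: "map_fm (\<lambda>_. i) ` S4 \<subseteq> Tack2"
  unfolding S4_def
  by (rule map_least_normal_subset[OF normal_Tack2]; cases i) (auto simp: in_Tack2_iff)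

lemma S5_Tack2: "map_fm (\<lambda>_. M2) ` S5 \<subseteq> Tack2"
  unfolding S5_def using S4_Tack2[of M2]
  by (intro map_least_normal_subset[OF normal_Tack2]) (auto simp: in_Tack2_iff)

lemma S4_B2_Tack2: "map_fm (\<lambda>_. M1) ` S4_B2 \<subseteq> Tack2"
proof -
  \<comment> \<open>In the first relation each row is a single cluster with only \<open>None\<close>
    above it, so strict chains have at most two points.\<close>
  have "map_fm (\<lambda>_. M1) (B_fm 2) \<in> Tack2"
    by (auto simp: in_Tack2_iff numeral_2_eq_2)
  then show ?thesis
    unfolding S4_B2_def using S4_Tack2[of M1]
    by (intro map_least_normal_subset[OF normal_Tack2]) auto
qed

text \<open>Every point reaches \<open>None\<close>, which sees only itself; hence both sides of the
  two McKinsey-type axioms say that \<open>p\<close> holds at \<open>None\<close>. In the last axiom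
  the premise puts \<open>q\<close> at \<open>None\<close>, so a successor refuting \<open>q\<close>
  lies in the same row and sees the starting point again.\<close>

lemma tack_logic_subset_Tack2: "tack_logic \<subseteq> Tack2"
proof -
  have "commutator S4_B2 S5 \<subseteq> Tack2"
    unfolding commutator_def
    by (intro least_normal_least normal_Tack2 Un_least S4_B2_Tack2 S5_Tack2)
      (auto simp: in_Tack2_iff)
  then show ?thesis
    unfolding tack_logic_def
    by (intro least_normal_least normal_Tack2 Un_least) (auto simp: in_Tack2_iff)
qed

section \<open>The canonical model\<close>

lemma prop_eval_Conj: "prop_eval v (Conj \<phi>s) \<longleftrightarrow> (\<forall>\<phi> \<in> set \<phi>s. prop_eval v \<phi>)"
  by (induction \<phi>s) auto

context normal_logic
begin

text \<open>Premises are moved one at a time into an implication and detached by modus ponens.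
  Propositional reasoning inside \<open>L\<close> thus reduces to a check of valuations.\<close>

lemma prop_consequence:
  assumes "set \<phi>s \<subseteq> L" "\<And>v. (\<forall>\<phi> \<in> set \<phi>s. prop_eval v \<phi>) \<Longrightarrow> prop_eval v \<psi>"
  shows "\<psi> \<in> L"
  using assms
proof (induction \<phi>s arbitrary: \<psi>)
  case Nil
  then show ?case by (auto intro: taut simp: tautology_def)
next
  case (Cons \<phi> \<phi>s)
  have "Imp \<phi> \<psi> \<in> L"
  proof (rule Cons.IH)
    show "set \<phi>s \<subseteq> L" using Cons.prems(1) by simp
    show "prop_eval v (Imp \<phi> \<psi>)" if "\<forall>\<phi> \<in> set \<phi>s. prop_eval v \<phi>" for v
      using Cons.prems(2)[of v] that by simp
  qed
  moreover have "\<phi> \<in> L" using Cons.prems(1) by simp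
  ultimately show ?case
    by (rule modus_ponens[rotated])
qed

lemma inconsistent_insert:
  assumes "\<not> consistent L (insert \<psi> \<Gamma>)"
  obtains \<phi>s where "set \<phi>s \<subseteq> \<Gamma>" "Imp (Conj \<phi>s) (Neg \<psi>) \<in> L"
proof -
  obtain \<phi>s where \<phi>s: "set \<phi>s \<subseteq> insert \<psi> \<Gamma>" "Neg (Conj \<phi>s) \<in> L"
    using assms by (auto simp: consistent_def)
  show thesis
  proof
    \<comment> \<open>Deleting \<psi> from the refuted list leaves members of \<Gamma> that refute
      \<psi>.\<close>
    show "set (filter (\<lambda>\<phi>. \<phi> \<noteq> \<psi>) \<phi>s) \<subseteq> \<Gamma>"
      using \<phi>s(1) by auto
    show "Imp (Conj (filter (\<lambda>\<phi>. \<phi> \<noteq> \<psi>) \<phi>s)) (Neg \<psi>) \<in> L"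
      by (rule prop_consequence[of "[Neg (Conj \<phi>s)]"]) (use \<phi>s(2) in \<open>auto simp: prop_eval_Conj\<close>)
  qed
qed

section \<open>Maximal consistent sets\<close>

lemma max_consistent_closed:
  assumes "max_consistent L \<Gamma>" "set \<phi>s \<subseteq> \<Gamma>" "Imp (Conj \<phi>s) \<psi> \<in> L"
  shows "\<psi> \<in> \<Gamma>"
proof (rule ccontr)
  assume "\<psi> \<notin> \<Gamma>"
  then have "\<not> consistent L (insert \<psi> \<Gamma>)"
    using assms(1) unfolding max_consistent_def by blast
  then obtain \<theta>s where \<theta>s: "set \<theta>s \<subseteq> \<Gamma>" "Imp (Conj \<theta>s) (Neg \<psi>) \<in> L"
    by (rule inconsistent_insert)
  have "Neg (Conj (\<phi>s @ \<theta>s)) \<in> L"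
    by (rule prop_consequence[of "[Imp (Conj \<phi>s) \<psi>, Imp (Conj \<theta>s) (Neg \<psi>)]"])
      (use assms(3) \<theta>s(2) in \<open>auto simp: prop_eval_Conj\<close>)
  moreover have "set (\<phi>s @ \<theta>s) \<subseteq> \<Gamma>"
    using assms(2) \<theta>s(1) by simp
  ultimately show False
    using assms(1) unfolding max_consistent_def consistent_def by blast
qed

lemma max_consistent_theorem:
  assumes "max_consistent L \<Gamma>" "\<psi> \<in> L"
  shows "\<psi> \<in> \<Gamma>"
proof (rule max_consistent_closed[OF assms(1)])
  show "set [] \<subseteq> \<Gamma>" by simp
  show "Imp (Conj []) \<psi> \<in> L"
    by (rule prop_consequence[of "[\<psi>]"]) (use assms(2) in auto)
qed

lemma max_consistent_Bot:
  assumes "max_consistent L \<Gamma>"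
  shows "Bot \<notin> \<Gamma>"
proof
  assume "Bot \<in> \<Gamma>"
  then have "set [Bot] \<subseteq> \<Gamma>" by simp
  moreover have "Neg (Conj [Bot]) \<in> L"
    by (rule taut) (simp add: tautology_def)
  ultimately show False
    using assms unfolding max_consistent_def consistent_def by blast
qed

lemma max_consistent_Imp:
  assumes "max_consistent L \<Gamma>"
  shows "Imp \<phi> \<psi> \<in> \<Gamma> \<longleftrightarrow> (\<phi> \<in> \<Gamma> \<longrightarrow> \<psi> \<in> \<Gamma>)"
proof (intro iffI impI)
  assume "Imp \<phi> \<psi> \<in> \<Gamma>" "\<phi> \<in> \<Gamma>"
  then show "\<psi> \<in> \<Gamma>"
    by (intro max_consistent_closed[OF assms, of "[\<phi>, Imp \<phi> \<psi>]"])
      (auto intro: taut simp: tautology_def)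
next
  assume *: "\<phi> \<in> \<Gamma> \<longrightarrow> \<psi> \<in> \<Gamma>"
  show "Imp \<phi> \<psi> \<in> \<Gamma>"
  proof (cases "\<psi> \<in> \<Gamma>")
    case True
    then show ?thesis
      by (intro max_consistent_closed[OF assms, of "[\<psi>]"]) (auto intro: taut simp: tautology_def)
  next
    case False
    then have "\<not> consistent L (insert \<phi> \<Gamma>)"
      using assms * unfolding max_consistent_def by blast
    then obtain \<theta>s where \<theta>s: "set \<theta>s \<subseteq> \<Gamma>" "Imp (Conj \<theta>s) (Neg \<phi>) \<in> L"
      by (rule inconsistent_insert)
    have "Imp (Conj \<theta>s) (Imp \<phi> \<psi>) \<in> L"
      by (rule prop_consequence[of "[Imp (Conj \<theta>s) (Neg \<phi>)]"]) (use \<theta>s(2) in auto)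
    then show ?thesis
      by (rule max_consistent_closed[OF assms \<theta>s(1)])
  qed
qed

lemma max_consistent_mp:
  "max_consistent L \<Gamma> \<Longrightarrow> Imp \<phi> \<psi> \<in> L \<Longrightarrow> \<phi> \<in> \<Gamma> \<Longrightarrow> \<psi> \<in> \<Gamma>"
  using max_consistent_theorem[of \<Gamma> "Imp \<phi> \<psi>"] by (simp add: max_consistent_Imp)

lemma max_consistent_Neg:
  "max_consistent L \<Gamma> \<Longrightarrow> Neg \<phi> \<in> \<Gamma> \<longleftrightarrow> \<phi> \<notin> \<Gamma>"
  by (simp add: max_consistent_Imp max_consistent_Bot)

text \<open>Closure under modus ponens puts every finite conjunction of members into \<Gamma>, so
  none is refutable, and any further formula would clash with its negation. This criterion later
  recognises the final point.\<close>

lemma max_consistentI: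
  assumes "L \<subseteq> \<Gamma>" "Bot \<notin> \<Gamma>"
    and mp: "\<And>\<phi> \<psi>. \<phi> \<in> \<Gamma> \<Longrightarrow> Imp \<phi> \<psi> \<in> \<Gamma> \<Longrightarrow> \<psi> \<in> \<Gamma>"
    and neg: "\<And>\<phi>. \<phi> \<in> \<Gamma> \<or> Neg \<phi> \<in> \<Gamma>"
  shows "max_consistent L \<Gamma>"
  unfolding max_consistent_def
proof (intro conjI allI impI)
  have Conj: "Conj \<phi>s \<in> \<Gamma>" if "set \<phi>s \<subseteq> \<Gamma>" for \<phi>s
    using that
  proof (induction \<phi>s)
    case Nil
    have "Top \<in> L" by (rule taut) (simp add: tautology_def)
    then show ?case using assms(1) by auto
  next
    case (Cons \<phi> \<phi>s)
    have "Imp \<phi> (Imp (Conj \<phi>s) (Conj (\<phi> # \<phi>s))) \<in> L"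
      by (rule taut) (simp add: tautology_def)
    then have "Imp \<phi> (Imp (Conj \<phi>s) (Conj (\<phi> # \<phi>s))) \<in> \<Gamma>"
      using assms(1) by blast
    moreover have "\<phi> \<in> \<Gamma>" "Conj \<phi>s \<in> \<Gamma>"
      using Cons by simp_all
    ultimately show ?case
      using mp by metis
  qed
  show "consistent L \<Gamma>"
    unfolding consistent_def
  proof (intro allI impI notI)
    fix \<phi>s assume "set \<phi>s \<subseteq> \<Gamma>" "Neg (Conj \<phi>s) \<in> L"
    then have "Conj \<phi>s \<in> \<Gamma>" "Neg (Conj \<phi>s) \<in> \<Gamma>"
      using Conj assms(1) by auto
    then show False using mp assms(2) by metis
  qed
  fix \<Delta> assume "\<Gamma> \<subset> \<Delta>"
  then obtain \<phi> where "\<phi> \<in> \<Delta>" "Neg \<phi> \<in> \<Delta>"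
    using neg by blast
  moreover have "Neg (Conj [\<phi>, Neg \<phi>]) \<in> L"
    by (rule taut) (simp add: tautology_def)
  ultimately show "\<not> consistent L \<Delta>"
    unfolding consistent_def by (metis empty_set empty_subsetI insert_subset list.simps(15))
qed

lemma max_consistent_eqI:
  assumes "max_consistent L \<Gamma>" "max_consistent L \<Delta>" "\<Gamma> \<subseteq> \<Delta>"
  shows "\<Gamma> = \<Delta>"
  using assms unfolding max_consistent_def by blast

text \<open>Zorn's lemma takes the place of an enumeration of formulas, since the type of modalities
  is arbitrary. Consistency passes to unions of chains because a list has only finitely many
  members.\<close>

lemma Lindenbaum:
  assumes "consistent L \<Gamma>"
  obtains \<Delta> where "\<Gamma> \<subseteq> \<Delta>" "max_consistent L \<Delta>"
proof -
  let ?A = "{\<Delta>. \<Gamma> \<subseteq> \<Delta> \<and> consistent L \<Delta>}"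
  have "\<exists>M\<in>?A. \<forall>X\<in>?A. M \<subseteq> X \<longrightarrow> X = M"
  proof (rule subset_Zorn_nonempty)
    show "?A \<noteq> {}" using assms by auto
  next
    fix C assume C: "C \<noteq> {}" "subset.chain ?A C"
    have "consistent L (\<Union>C)"
      unfolding consistent_def
    proof (intro allI impI)
      fix \<phi>s assume "set \<phi>s \<subseteq> \<Union>C"
      then obtain B where "B \<in> C" "set \<phi>s \<subseteq> B"
        using finite_subset_Union_chain[OF _ _ C] by blast
      then show "Neg (Conj \<phi>s) \<notin> L"
        using C(2) unfolding subset.chain_def consistent_def by blast
    qed
    then show "\<Union>C \<in> ?A"
      using C unfolding subset.chain_def by blast
  qed
  then obtain \<Delta> where \<Delta>: "\<Delta> \<in> ?A" and max: "\<forall>X\<in>?A. \<Delta> \<subseteq> X \<longrightarrow> X = \<Delta>"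
    by (rule bexE)
  have "\<not> consistent L X" if "\<Delta> \<subset> X" for X
  proof
    assume "consistent L X"
    then have "X \<in> ?A" using \<Delta> that by auto
    then show False using max that by auto
  qed
  then have "max_consistent L \<Delta>"
    using \<Delta> unfolding max_consistent_def by simp
  then show thesis
    using that[of \<Delta>] \<Delta> by simp
qed

text \<open>Consistency speaks of finite lists only, so each list may be realised in a maximal
  consistent set of its own.\<close>

lemma compactness:
  assumes "\<And>\<phi>s. set \<phi>s \<subseteq> \<Gamma> \<Longrightarrow> \<exists>\<Delta>. max_consistent L \<Delta> \<and> set \<phi>s \<subseteq> \<Delta>"
  obtains \<Delta> where "\<Gamma> \<subseteq> \<Delta>" "max_consistent L \<Delta>"
proof -
  have "consistent L \<Gamma>"
    unfolding consistent_def
  proof (intro allI impI)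
    fix \<phi>s assume "set \<phi>s \<subseteq> \<Gamma>"
    then show "Neg (Conj \<phi>s) \<notin> L"
      using assms unfolding max_consistent_def consistent_def by blast
  qed
  then show thesis
    by (rule Lindenbaum) (rule that)
qed

section \<open>The canonical relations and the truth lemma\<close>

abbreviation can_rel :: "'m fm set \<Rightarrow> 'm \<Rightarrow> 'm fm set \<Rightarrow> bool" where
  "can_rel \<Gamma> i \<Delta> \<equiv> (\<Gamma>, \<Delta>) \<in> rel (canonical_frame L) i"

lemma can_rel_iff:
  "can_rel \<Gamma> i \<Delta> \<longleftrightarrow>
     max_consistent L \<Gamma> \<and> max_consistent L \<Delta> \<and> (\<forall>\<phi> \<in> \<Delta>. Dia i \<phi> \<in> \<Gamma>)"
  by (simp add: canonical_frame_def)

lemma worlds_canonical: "\<Gamma> \<in> worlds (canonical_frame L) \<longleftrightarrow> max_consistent L \<Gamma>"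
  by (simp add: canonical_frame_def)

lemma dia_or_instance: "Imp (Dia i (Or \<phi> \<psi>)) (Or (Dia i \<phi>) (Dia i \<psi>)) \<in> L"
  using substitution[OF dia_or[of i], of "\<lambda>n. if n = 0 then \<phi> else \<psi>"] by simp

lemma max_consistent_Dia_mono:
  "max_consistent L \<Gamma> \<Longrightarrow> Imp \<phi> \<psi> \<in> L \<Longrightarrow> Dia i \<phi> \<in> \<Gamma> \<Longrightarrow> Dia i \<psi> \<in> \<Gamma>"
  by (rule max_consistent_mp[OF _ monotonicity])

text \<open>The dual form of the distribution of boxes over finite conjunctions, proved from the two
  diamond axioms by splitting off one conjunct at a time.\<close>

lemma max_consistent_Dia_Neg_Conj:
  assumes "max_consistent L \<Gamma>" "Dia i (Neg (Conj \<phi>s)) \<in> \<Gamma>"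
  shows "\<exists>\<phi> \<in> set \<phi>s. Dia i (Neg \<phi>) \<in> \<Gamma>"
  using assms(2)
proof (induction \<phi>s)
  case Nil
  have "Imp (Neg (Conj [])) Bot \<in> L"
    by (rule taut) (simp add: tautology_def)
  then have "Dia i Bot \<in> \<Gamma>"
    using Nil by (rule max_consistent_Dia_mono[OF assms(1)])
  then have "Bot \<in> \<Gamma>"
    by (rule max_consistent_mp[OF assms(1) dia_bot])
  then show ?case
    using max_consistent_Bot[OF assms(1)] by blast
next
  case (Cons \<phi> \<phi>s)
  have "Imp (Neg (Conj (\<phi> # \<phi>s))) (Or (Neg \<phi>) (Neg (Conj \<phi>s))) \<in> L"
    by (rule taut) (simp add: tautology_def)
  then have "Dia i (Or (Neg \<phi>) (Neg (Conj \<phi>s))) \<in> \<Gamma>"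
    using Cons.prems by (rule max_consistent_Dia_mono[OF assms(1)])
  then have "Or (Dia i (Neg \<phi>)) (Dia i (Neg (Conj \<phi>s))) \<in> \<Gamma>"
    by (rule max_consistent_mp[OF assms(1) dia_or_instance])
  then have "Dia i (Neg \<phi>) \<in> \<Gamma> \<or> Dia i (Neg (Conj \<phi>s)) \<in> \<Gamma>"
    using assms(1) by (auto simp: max_consistent_Imp max_consistent_Bot)
  then show ?case
    using Cons.IH by auto
qed

lemma can_relI:
  assumes "max_consistent L \<Gamma>" "max_consistent L \<Delta>" "\<And>\<phi>. Box i \<phi> \<in> \<Gamma> \<Longrightarrow> \<phi> \<in> \<Delta>"
  shows "can_rel \<Gamma> i \<Delta>"
  unfolding can_rel_iff
proof (intro conjI ballI assms(1,2))
  fix \<phi> assume "\<phi> \<in> \<Delta>"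
  then have "Box i (Neg \<phi>) \<notin> \<Gamma>"
    using assms(3)[of "Neg \<phi>"] max_consistent_Neg[OF assms(2), of \<phi>] by blast
  \<comment> \<open>As \<open>Dia\<close> is primitive, negating the box leaves a double negation
    under the diamond; monotonicity removes it.\<close>
  then have "Dia i (Neg (Neg \<phi>)) \<in> \<Gamma>"
    by (simp add: max_consistent_Neg[OF assms(1)])
  moreover have "Imp (Neg (Neg \<phi>)) \<phi> \<in> L"
    by (rule taut) (simp add: tautology_def)
  ultimately show "Dia i \<phi> \<in> \<Gamma>"
    by (rule max_consistent_Dia_mono[OF assms(1), rotated])
qed

lemma can_rel_Box: "can_rel \<Gamma> i \<Delta> \<Longrightarrow> Box i \<phi> \<in> \<Gamma> \<Longrightarrow> \<phi> \<in> \<Delta>"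
  using max_consistent_Neg[of \<Delta> \<phi>] max_consistent_Neg[of \<Gamma> "Dia i (Neg \<phi>)"]
  unfolding can_rel_iff by blast

lemma existence:
  assumes \<Gamma>: "max_consistent L \<Gamma>" and Dia: "Dia i \<psi> \<in> \<Gamma>"
  obtains \<Delta> where "can_rel \<Gamma> i \<Delta>" "\<psi> \<in> \<Delta>"
proof -
  have "consistent L (insert \<psi> {\<phi>. Box i \<phi> \<in> \<Gamma>})"
  proof (rule ccontr)
    assume "\<not> ?thesis"
    then obtain \<theta>s where \<theta>s: "set \<theta>s \<subseteq> {\<phi>. Box i \<phi> \<in> \<Gamma>}" "Imp (Conj \<theta>s) (Neg \<psi>) \<in> L"
      by (rule inconsistent_insert)
    have "Imp \<psi> (Neg (Conj \<theta>s)) \<in> L"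
      by (rule prop_consequence[of "[Imp (Conj \<theta>s) (Neg \<psi>)]"]) (use \<theta>s(2) in auto)
    then have "Dia i (Neg (Conj \<theta>s)) \<in> \<Gamma>"
      using Dia by (rule max_consistent_Dia_mono[OF \<Gamma>])
    then obtain \<theta> where "\<theta> \<in> set \<theta>s" "Dia i (Neg \<theta>) \<in> \<Gamma>"
      using max_consistent_Dia_Neg_Conj[OF \<Gamma>] by blast
    then show False
      using \<theta>s(1) by (auto simp: max_consistent_Neg[OF \<Gamma>])
  qed
  then obtain \<Delta> where "insert \<psi> {\<phi>. Box i \<phi> \<in> \<Gamma>} \<subseteq> \<Delta>" "max_consistent L \<Delta>"
    by (rule Lindenbaum)
  then show thesis
    using that[of \<Delta>] can_relI[OF \<Gamma>] by auto
qed

text \<open>The midpoint has to contain the boxed part of \<Gamma> and \<open>Dia j\<close> of all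
  of \<Delta>. By compactness only finitely many members of \<Delta> count at a time; their
  conjunction lies in \<Delta>, so one application of \<open>existence\<close> serves them all. This
  turns an inclusion between compound diamonds into one between composed relations.\<close>

lemma can_rel_compose:
  assumes \<Gamma>: "max_consistent L \<Gamma>" and \<Delta>: "max_consistent L \<Delta>"
    and Dia: "\<And>\<phi>. \<phi> \<in> \<Delta> \<Longrightarrow> Dia i (Dia j \<phi>) \<in> \<Gamma>"
  obtains \<Theta> where "can_rel \<Gamma> i \<Theta>" "can_rel \<Theta> j \<Delta>"
proof -
  obtain \<Theta> where \<Theta>: "{\<phi>. Box i \<phi> \<in> \<Gamma>} \<union> Dia j ` \<Delta> \<subseteq> \<Theta>" "max_consistent L \<Theta>"
  proof (rule compactness)
    fix \<phi>s assume \<phi>s: "set \<phi>s \<subseteq> {\<phi>. Box i \<phi> \<in> \<Gamma>} \<union> Dia j ` \<Delta>"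
    have "finite (set \<phi>s \<inter> Dia j ` \<Delta>)" by simp
    then obtain D where D: "D \<subseteq> \<Delta>" "finite D" "set \<phi>s \<inter> Dia j ` \<Delta> = Dia j ` D"
      using finite_subset_image by (metis inf_le2)
    obtain \<psi>s where \<psi>s: "set \<psi>s = D"
      using D(2) finite_list by blast
    have "Conj \<psi>s \<in> \<Delta>"
      using \<psi>s D(1) by (intro max_consistent_closed[OF \<Delta>, of \<psi>s] taut) (auto simp: tautology_def)
    then have "Dia i (Dia j (Conj \<psi>s)) \<in> \<Gamma>"
      by (rule Dia)
    then obtain \<Theta> where \<Theta>: "can_rel \<Gamma> i \<Theta>" "Dia j (Conj \<psi>s) \<in> \<Theta>"
      using \<Gamma> existence by blast
    have mc: "max_consistent L \<Theta>"
      using \<Theta>(1) can_rel_iff by blast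
    have "Dia j \<psi> \<in> \<Theta>" if "\<psi> \<in> D" for \<psi>
    proof (rule max_consistent_Dia_mono[OF mc _ \<Theta>(2)])
      show "Imp (Conj \<psi>s) \<psi> \<in> L"
        using that \<psi>s by (auto intro: taut simp: tautology_def prop_eval_Conj)
    qed
    then have "set \<phi>s \<subseteq> \<Theta>"
      using \<phi>s D(3) can_rel_Box[OF \<Theta>(1)] by blast
    then show "\<exists>\<Delta>. max_consistent L \<Delta> \<and> set \<phi>s \<subseteq> \<Delta>"
      using mc by blast
  qed
  show thesis
  proof
    show "can_rel \<Gamma> i \<Theta>" using \<Theta> by (intro can_relI[OF \<Gamma>]) auto
    show "can_rel \<Theta> j \<Delta>" using \<Theta> \<Delta> by (auto simp: can_rel_iff)
  qed
qed

abbreviation can_sat :: "'m fm set \<Rightarrow> 'm fm \<Rightarrow> bool" where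
  "can_sat \<equiv> sat (canonical_frame L) (\<lambda>n. {\<Gamma>. Var n \<in> \<Gamma>})"

lemma truth: "max_consistent L \<Gamma> \<Longrightarrow> can_sat \<Gamma> \<phi> \<longleftrightarrow> \<phi> \<in> \<Gamma>"
proof (induction \<phi> arbitrary: \<Gamma>)
  case (Dia i \<phi>)
  have "(\<exists>\<Delta>. max_consistent L \<Delta> \<and> can_rel \<Gamma> i \<Delta> \<and> \<phi> \<in> \<Delta>) \<longleftrightarrow> Dia i \<phi> \<in> \<Gamma>"
    using existence[OF Dia.prems] can_rel_iff by metis
  then show ?case
    using Dia.IH by (auto simp: worlds_canonical sat.simps(4))
qed (auto simp: max_consistent_Imp max_consistent_Bot)

text \<open>The negation of a non-theorem extends to a maximal consistent set, and there the
  canonical valuation refutes the formula.\<close>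

lemma logic_of_canonical_frame_subset: "logic_of (canonical_frame L) \<subseteq> L"
proof
  fix \<phi> assume \<phi>: "\<phi> \<in> logic_of (canonical_frame L)"
  show "\<phi> \<in> L"
  proof (rule ccontr)
    assume "\<phi> \<notin> L"
    have "consistent L {Neg \<phi>}"
      unfolding consistent_def
    proof (intro allI impI notI)
      fix \<phi>s assume "set \<phi>s \<subseteq> {Neg \<phi>}" "Neg (Conj \<phi>s) \<in> L"
      then have "\<phi> \<in> L"
        by (intro prop_consequence[of "[Neg (Conj \<phi>s)]"]) (auto simp: prop_eval_Conj)
      then show False using \<open>\<phi> \<notin> L\<close> by blast
    qed
    then obtain \<Delta> where "{Neg \<phi>} \<subseteq> \<Delta>" "max_consistent L \<Delta>"
      by (rule Lindenbaum)
    moreover from this have "can_sat \<Delta> \<phi>"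
      using \<phi> by (auto simp: logic_of_def valid_def worlds_canonical)
    ultimately show False
      by (simp add: truth max_consistent_Neg)
  qed
qed

end

section \<open>Tack-like frames\<close>

text \<open>The final point \<open>t\<close> may depend on \<open>w\<close>: the canonical frame
  need not be connected, and different pieces may have different tops.\<close>

definition tack_like :: "(modality, 'w) frame \<Rightarrow> bool" where
  "tack_like F \<longleftrightarrow>
     (\<forall>i. rel F i \<subseteq> worlds F \<times> worlds F \<and> refl_on (worlds F) (rel F i) \<and> trans (rel F i)) \<and>
     sym (rel F M2) \<and> rel F M1 O rel F M2 = rel F M2 O rel F M1 \<and>
     (\<forall>w \<in> worlds F. \<exists>t \<in> worlds F. (w, t) \<in> rel F M1 \<and> (\<forall>i u. (t, u) \<in> rel F i \<longrightarrow> u = t) \<and>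
        (\<forall>u. (w, u) \<in> rel F M1 \<longrightarrow> u \<noteq> t \<longrightarrow> (u, w) \<in> rel F M1))"

section \<open>Filtration onto the grid\<close>

primrec subformulas :: "'m fm \<Rightarrow> 'm fm set" where
  "subformulas (Var n) = {Var n}"
| "subformulas Bot = {Bot}"
| "subformulas (Imp \<phi> \<psi>) = insert (Imp \<phi> \<psi>) (subformulas \<phi> \<union> subformulas \<psi>)"
| "subformulas (Dia i \<phi>) = insert (Dia i \<phi>) (subformulas \<phi>)"

lemma finite_subformulas: "finite (subformulas \<phi>)"
  by (induction \<phi>) auto

lemma subformulas_self: "\<phi> \<in> subformulas \<phi>"
  by (cases \<phi>) auto

lemma subformulas_Imp: "Imp \<phi> \<psi> \<in> subformulas \<chi> \<Longrightarrow> \<phi> \<in> subformulas \<chi> \<and> \<psi> \<in> subformulas \<chi>"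
  by (induction \<chi>) (auto simp: subformulas_self)

lemma subformulas_Dia: "Dia i \<phi> \<in> subformulas \<chi> \<Longrightarrow> \<phi> \<in> subformulas \<chi>"
  by (induction \<chi>) (auto simp: subformulas_self)

text \<open>
  Coordinates are pairs \<open>(j, g)\<close> and \<open>(i, h)\<close>: \<open>j\<close> and \<open>i\<close> name a column and a row, and
  \<open>\<bar>g - h\<bar>\<close> names the element placed in their intersection. Since \<open>\<bar>g - h\<bar>\<close> is onto in each
  argument separately, every row and every column exhausts the elements belonging to it.
\<close>

lemma grid_exists:
  fixes A :: "'w \<Rightarrow> 'a" and B :: "'w \<Rightarrow> 'b" and \<tau> :: "'w \<Rightarrow> 'c"
  assumes fin: "finite ((\<lambda>x. (\<tau> x, A x, B x)) ` W)" and "W \<noteq> {}"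
    and mid: "\<And>x y. x \<in> W \<Longrightarrow> y \<in> W \<Longrightarrow> \<exists>u \<in> W. A u = A x \<and> B u = B y"
  obtains f :: "nat \<Rightarrow> nat \<Rightarrow> 'w" where
    "\<And>a b. f a b \<in> W"
    "\<And>a a' b. A (f a b) = A (f a' b)" "\<And>a b b'. B (f a b) = B (f a b')"
    "\<And>x a b. x \<in> W \<Longrightarrow> A x = A (f a b) \<Longrightarrow> \<exists>a'. \<tau> (f a' b) = \<tau> x"
    "\<And>x a b. x \<in> W \<Longrightarrow> B x = B (f a b) \<Longrightarrow> \<exists>b'. \<tau> (f a b') = \<tau> x"
    "\<And>x. x \<in> W \<Longrightarrow> \<exists>a b. \<tau> (f a b) = \<tau> x"
proof -
  let ?key = "\<lambda>x. (\<tau> x, A x, B x)"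
  \<comment> \<open>Since there are finitely many keys, they can be listed along the natural
    numbers. \<open>k n\<close> is a representative of the key at index \<open>n\<close>; every key
    is met, possibly more than once.\<close>
  define k where "k n = inv_into W ?key (from_nat_into (?key ` W) n)" for n
  have range: "from_nat_into (?key ` W) n \<in> ?key ` W" for n
    using \<open>W \<noteq> {}\<close> by (intro from_nat_into) simp
  have k: "k n \<in> W" for n
    unfolding k_def by (rule inv_into_into[OF range])
  have onto: "\<exists>n. \<tau> (k n) = \<tau> x \<and> A (k n) = A x \<and> B (k n) = B x" if x: "x \<in> W" for x
  proof -
    have "?key x \<in> ?key ` W" using x by (rule imageI)
    then obtain n where n: "from_nat_into (?key ` W) n = ?key x"
      using from_nat_into_surj[OF countable_finite[OF fin]] by blast
    have "?key (k n) = ?key x"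
      unfolding k_def n[symmetric] by (rule f_inv_into_f[OF range])
    then show ?thesis by blast
  qed
  \<comment> \<open>Row \<open>i\<close> carries the \<open>A\<close>-value of \<open>k i\<close>,
    column \<open>j\<close> the \<open>B\<close>-value of \<open>k j\<close>. The point
    \<open>k m\<close> is placed where they meet if it has both values; otherwise a default with
    these values comes from \<open>mid\<close>.\<close>
  define g where "g j i m =
    (if A (k m) = A (k i) \<and> B (k m) = B (k j) then k m
     else (SOME u. u \<in> W \<and> A u = A (k i) \<and> B u = B (k j)))" for j i m
  have g: "g j i m \<in> W \<and> A (g j i m) = A (k i) \<and> B (g j i m) = B (k j)" for j i m
  proof (cases "A (k m) = A (k i) \<and> B (k m) = B (k j)")
    case True
    then show ?thesis by (simp add: g_def k)
  next
    case False
    then have "g j i m = (SOME u. u \<in> W \<and> A u = A (k i) \<and> B u = B (k j))"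
      unfolding g_def by (rule if_not_P)
    moreover have "\<exists>u. u \<in> W \<and> A u = A (k i) \<and> B u = B (k j)"
      using mid[OF k k] by blast
    ultimately show ?thesis
      by (metis (mono_tags, lifting) someI_ex)
  qed
  \<comment> \<open>Truncated subtraction in both directions adds up to the absolute difference of
    the second components.\<close>
  define f where "f a b = g (fst (prod_decode a)) (fst (prod_decode b))
    ((snd (prod_decode a) - snd (prod_decode b)) + (snd (prod_decode b) - snd (prod_decode a)))"
    for a b
  show thesis
  proof
    show "f a b \<in> W" "A (f a b) = A (f a' b)" "B (f a b) = B (f a b')" for a a' b b'
      by (simp_all add: f_def g)
    show "\<exists>a'. \<tau> (f a' b) = \<tau> x" if x: "x \<in> W" and eq: "A x = A (f a b)" for x a b
    proof -
      obtain n where n: "\<tau> (k n) = \<tau> x" "A (k n) = A x"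
        using onto[OF x] by blast
      have "A (k n) = A (k (fst (prod_decode b)))"
        using n(2) eq by (simp add: f_def g)
      \<comment> \<open>A column named \<open>n\<close> automatically has the \<open>B\<close>-value
        of \<open>k n\<close>, and the shift by \<open>n\<close> makes the difference equal to
        \<open>n\<close>. The case of columns below is symmetric.\<close>
      then have "f (prod_encode (n, snd (prod_decode b) + n)) b = k n"
        by (simp add: f_def g_def)
      then show ?thesis using n(1) by metis
    qed
    show "\<exists>b'. \<tau> (f a b') = \<tau> x" if x: "x \<in> W" and eq: "B x = B (f a b)" for x a b
    proof -
      obtain n where n: "\<tau> (k n) = \<tau> x" "B (k n) = B x"
        using onto[OF x] by blast
      have "B (k n) = B (k (fst (prod_decode a)))"
        using n(2) eq by (simp add: f_def g)
      then have "f a (prod_encode (n, snd (prod_decode a) + n)) = k n"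
        by (simp add: f_def g_def)
      then show ?thesis using n(1) by metis
    qed
    show "\<exists>a b. \<tau> (f a b) = \<tau> x" if x: "x \<in> W" for x
    proof -
      obtain n where n: "\<tau> (k n) = \<tau> x"
        using onto[OF x] by blast
      have "f (prod_encode (n, n)) (prod_encode (n, 0)) = k n"
        by (simp add: f_def g_def)
      then show ?thesis using n by metis
    qed
  qed
qed

text \<open>
  A filtration: a point is remembered by its \<open>\<phi>\<close>-type together with the sets of \<open>\<phi>\<close>-types
  occurring in its row and in its column.
\<close>

lemma tack_model_exists:
  fixes F :: "(modality, 'w) frame" and \<phi> :: "modality fm"
  assumes W: "W \<subseteq> worlds F" "w \<in> W" and t: "t \<in> worlds F"
    and t_rel: "\<And>i u. (t, u) \<in> rel F i \<longleftrightarrow> u = t"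
    and M1_cases: "\<And>x u. x \<in> W \<Longrightarrow> (x, u) \<in> rel F M1 \<Longrightarrow> u = t \<or> u \<in> W"
    and M1_t: "\<And>x. x \<in> W \<Longrightarrow> (x, t) \<in> rel F M1"
    and M2_W: "\<And>x u. x \<in> W \<Longrightarrow> (x, u) \<in> rel F M2 \<Longrightarrow> u \<in> W"
    and equiv: "\<And>i. equiv W (rel F i \<inter> W \<times> W)"
    and mid: "\<And>x y. x \<in> W \<Longrightarrow> y \<in> W \<Longrightarrow> \<exists>u \<in> W. (x, u) \<in> rel F M1 \<and> (u, y) \<in> rel F M2"
  shows "\<exists>V' a b. tack_sat V' (Some (a, b)) \<phi> \<longleftrightarrow>
           sat F V w \<phi>"
proof -
  define \<tau> where "\<tau> x = {\<psi> \<in> subformulas \<phi>. sat F V x \<psi>}" for x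
  define T where "T i x = \<tau> ` {y \<in> W. (x, y) \<in> rel F i}" for i x
  have T_eq: "T i x = T i y" if "(x, y) \<in> rel F i" "x \<in> W" "y \<in> W" for i x y
  proof -
    have "{z \<in> W. (x, z) \<in> rel F i} = {z \<in> W. (y, z) \<in> rel F i}"
      using that equiv[of i] unfolding equiv_def sym_def trans_def by blast
    then show ?thesis by (simp add: T_def)
  qed
  have \<tau>_T: "\<tau> x \<in> T i x" if "x \<in> W" for i x
    using that equiv[of i] unfolding T_def equiv_def refl_on_def by blast
  have "(\<lambda>x. (\<tau> x, T M1 x, T M2 x)) ` W \<subseteq>
    Pow (subformulas \<phi>) \<times> Pow (Pow (subformulas \<phi>)) \<times> Pow (Pow (subformulas \<phi>))"
    by (auto simp: \<tau>_def T_def)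
  then have fin: "finite ((\<lambda>x. (\<tau> x, T M1 x, T M2 x)) ` W)"
    by (rule finite_subset) (simp add: finite_subformulas)
  \<comment> \<open>\<open>T i\<close> is constant on the classes of the relation \<open>i\<close>,
    so the midpoint in \<open>W\<close> inherits its row value from \<open>x\<close> and its column
    value from \<open>y\<close>.\<close>
  have T_mid: "\<exists>u \<in> W. T M1 u = T M1 x \<and> T M2 u = T M2 y" if "x \<in> W" "y \<in> W" for x y
    using mid[OF that] that T_eq by metis
  have "W \<noteq> {}" using W(2) by blast
  obtain f :: "nat \<Rightarrow> nat \<Rightarrow> 'w" where f: "\<And>a b. f a b \<in> W"
    and row: "\<And>a a' b. T M1 (f a b) = T M1 (f a' b)"
    and col: "\<And>a b b'. T M2 (f a b) = T M2 (f a b')"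
    and row_onto: "\<And>x a b. x \<in> W \<Longrightarrow> T M1 x = T M1 (f a b) \<Longrightarrow> \<exists>a'. \<tau> (f a' b) = \<tau> x"
    and col_onto: "\<And>x a b. x \<in> W \<Longrightarrow> T M2 x = T M2 (f a b) \<Longrightarrow> \<exists>b'. \<tau> (f a b') = \<tau> x"
    and onto: "\<And>x. x \<in> W \<Longrightarrow> \<exists>a b. \<tau> (f a b) = \<tau> x"
    using grid_exists[OF fin \<open>W \<noteq> {}\<close> T_mid] by blast
  \<comment> \<open>The grid row realises exactly the types of the class it stands for:
    \<open>row_onto\<close> supplies each of them, and conversely every \<open>f a' b\<close> has
    the same \<open>T M1\<close> and its own type belongs to it.\<close>
  have row_types: "T M1 (f a b) = range (\<lambda>a'. \<tau> (f a' b))" for a b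
  proof
    show "T M1 (f a b) \<subseteq> range (\<lambda>a'. \<tau> (f a' b))"
    proof
      fix s assume "s \<in> T M1 (f a b)"
      then obtain y where y: "y \<in> W" "(f a b, y) \<in> rel F M1" "s = \<tau> y"
        unfolding T_def by blast
      then show "s \<in> range (\<lambda>a'. \<tau> (f a' b))"
        using row_onto[of y a b] T_eq[OF y(2) f y(1)] by (metis rangeI)
    qed
    show "range (\<lambda>a'. \<tau> (f a' b)) \<subseteq> T M1 (f a b)"
      using \<tau>_T f row by blast
  qed
  have col_types: "T M2 (f a b) = range (\<lambda>b'. \<tau> (f a b'))" for a b
  proof
    show "T M2 (f a b) \<subseteq> range (\<lambda>b'. \<tau> (f a b'))"
    proof
      fix s assume "s \<in> T M2 (f a b)"
      then obtain y where y: "y \<in> W" "(f a b, y) \<in> rel F M2" "s = \<tau> y"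
        unfolding T_def by blast
      then show "s \<in> range (\<lambda>b'. \<tau> (f a b'))"
        using col_onto[of y a b] T_eq[OF y(2) f y(1)] by (metis rangeI)
    qed
    show "range (\<lambda>b'. \<tau> (f a b')) \<subseteq> T M2 (f a b)"
      using \<tau>_T f col by blast
  qed
  have T_sat: "(\<exists>u \<in> W. (x, u) \<in> rel F i \<and> sat F V u \<psi>) \<longleftrightarrow> (\<exists>s \<in> T i x. \<psi> \<in> s)"
    if "\<psi> \<in> subformulas \<phi>" for i x \<psi>
    using that by (auto simp: T_def \<tau>_def)
  have \<tau>_sat: "\<psi> \<in> \<tau> x \<longleftrightarrow> sat F V x \<psi>" if "\<psi> \<in> subformulas \<phi>" for x \<psi>
    using that by (simp add: \<tau>_def)
  define V' where "V' n = {p. case p of None \<Rightarrow> t \<in> V n | Some (a, b) \<Rightarrow> f a b \<in> V n}" for n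
  \<comment> \<open>At the final point diamonds are trivial, so agreement holds for all formulas. On
    the grid only types are preserved, hence the restriction to subformulas of \<phi> in the next
    claim.\<close>
  have None: "tack_sat V' None \<psi> \<longleftrightarrow> sat F V t \<psi>" for \<psi>
    by (induction \<psi>) (auto simp: V'_def sat.simps(4)[of F] t_rel t)
  have Some: "tack_sat V' (Some (a, b)) \<psi> \<longleftrightarrow> sat F V (f a b) \<psi>" if "\<psi> \<in> subformulas \<phi>" for \<psi> a b
    using that
  proof (induction \<psi> arbitrary: a b)
    case (Imp \<psi> \<chi>)
    then have "\<psi> \<in> subformulas \<phi>" "\<chi> \<in> subformulas \<phi>"
      using subformulas_Imp by blast+
    then show ?case using Imp.IH by simp
  next
    case (Dia i \<psi>)
    have \<psi>: "\<psi> \<in> subformulas \<phi>"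
      using Dia.prems by (rule subformulas_Dia)
    show ?case
    proof (cases i)
      case M1
      have "sat F V (f a b) (Dia M1 \<psi>) \<longleftrightarrow>
          sat F V t \<psi> \<or> (\<exists>u \<in> W. (f a b, u) \<in> rel F M1 \<and> sat F V u \<psi>)"
        unfolding sat.simps(4) using W(1) t M1_cases M1_t f by blast
      also have "\<dots> \<longleftrightarrow> sat F V t \<psi> \<or> (\<exists>a'. sat F V (f a' b) \<psi>)"
        unfolding T_sat[OF \<psi>] row_types by (simp add: \<tau>_sat[OF \<psi>])
      finally show ?thesis
        using M1 None Dia.IH[OF \<psi>] by simp
    next
      case M2
      have "sat F V (f a b) (Dia M2 \<psi>) \<longleftrightarrow> (\<exists>u \<in> W. (f a b, u) \<in> rel F M2 \<and> sat F V u \<psi>)"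
        unfolding sat.simps(4) using W(1) M2_W f by blast
      also have "\<dots> \<longleftrightarrow> (\<exists>b'. sat F V (f a b') \<psi>)"
        unfolding T_sat[OF \<psi>] col_types by (simp add: \<tau>_sat[OF \<psi>])
      finally show ?thesis
        using M2 Dia.IH[OF \<psi>] by simp
    qed
  qed (auto simp: V'_def)
  obtain a b where "\<tau> (f a b) = \<tau> w"
    using onto W(2) by blast
  then have "sat F V (f a b) \<phi> \<longleftrightarrow> sat F V w \<phi>"
    using \<tau>_sat[OF subformulas_self] by blast
  then show ?thesis
    using Some[OF subformulas_self] by blast
qed

text \<open>A world is either final, and then behaves like \<open>None\<close>, or it generates a
  piece consisting of \<open>t\<close> above a set \<open>W\<close> to which the filtration
  applies.\<close>

lemma Tack2_subset_logic_of:
  assumes "tack_like F"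
  shows "Tack2 \<subseteq> logic_of F"
proof
  fix \<phi> assume \<phi>: "\<phi> \<in> Tack2"
  have "sat F V w \<phi>" if w: "w \<in> worlds F" for V w
  proof -
    have sub: "rel F i \<subseteq> worlds F \<times> worlds F" for i
      using assms unfolding tack_like_def by blast
    have refl: "(x, x) \<in> rel F i" if "x \<in> worlds F" for x i
      using assms that unfolding tack_like_def refl_on_def by blast
    have trans: "(x, y) \<in> rel F i \<Longrightarrow> (y, z) \<in> rel F i \<Longrightarrow> (x, z) \<in> rel F i" for x y z i
      using assms unfolding tack_like_def trans_def by blast
    have sym: "(x, y) \<in> rel F M2 \<Longrightarrow> (y, x) \<in> rel F M2" for x y
      using assms unfolding tack_like_def sym_def by blast
    have com: "\<exists>v. (x, v) \<in> rel F M1 \<and> (v, z) \<in> rel F M2"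
      if "(x, y) \<in> rel F M2" "(y, z) \<in> rel F M1" for x y z
      using assms that unfolding tack_like_def by blast
    have top: "\<exists>t \<in> worlds F. (x, t) \<in> rel F M1 \<and> (\<forall>i u. (t, u) \<in> rel F i \<longrightarrow> u = t) \<and>
        (\<forall>u. (x, u) \<in> rel F M1 \<longrightarrow> u \<noteq> t \<longrightarrow> (u, x) \<in> rel F M1)" if "x \<in> worlds F" for x
      using assms that unfolding tack_like_def by blast
    obtain t where t: "t \<in> worlds F" "(w, t) \<in> rel F M1"
      and t_final: "\<And>i u. (t, u) \<in> rel F i \<Longrightarrow> u = t"
      and w_back: "\<And>u. (w, u) \<in> rel F M1 \<Longrightarrow> u \<noteq> t \<Longrightarrow> (u, w) \<in> rel F M1"
      using top[OF w] by blast
    have t_rel: "(t, u) \<in> rel F i \<longleftrightarrow> u = t" for i u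
      using t_final refl[OF t(1)] by blast
    show ?thesis
    proof (cases "w = t")
      case True
      have "tack_sat (\<lambda>n. if t \<in> V n then UNIV else {})
          None \<psi> \<longleftrightarrow> sat F V t \<psi>" for \<psi>
        by (induction \<psi>) (auto simp: sat.simps(4)[of F] t_rel t(1))
      then show ?thesis
        using \<phi> True unfolding in_Tack2_iff by blast
    next
      case False
      \<comment> \<open>One step of each relation suffices to generate the piece, because the
        relations are transitive and commute.\<close>
      define W where "W = {x. x \<noteq> t \<and> (\<exists>v. (w, v) \<in> rel F M1 \<and> (v, x) \<in> rel F M2)}"
      have W_sub: "W \<subseteq> worlds F"
        using sub unfolding W_def by blast
      have wW: "w \<in> W"
        using False refl[OF w] unfolding W_def by blast
      \<comment> \<open>All of \<open>W\<close> shares the top \<open>t\<close>: the step from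
        \<open>v\<close> to \<open>t\<close> is carried along the second relation to
        \<open>x\<close>, and the endpoint is related to \<open>t\<close> by the symmetric second
        relation, so it equals \<open>t\<close>.\<close>
      have M1_t: "(x, t) \<in> rel F M1" if x: "x \<in> W" for x
      proof -
        obtain v where v: "(w, v) \<in> rel F M1" "(v, x) \<in> rel F M2" "x \<noteq> t"
          using x unfolding W_def by blast
        have "v \<noteq> t" using v t_final by blast
        then have "(v, t) \<in> rel F M1"
          using w_back v(1) t(2) trans by blast
        then obtain u where "(x, u) \<in> rel F M1" "(u, t) \<in> rel F M2"
          using com sym v(2) by blast
        then show ?thesis using sym t_final by blast
      qed
      have M2_W: "y \<in> W" if "x \<in> W" "(x, y) \<in> rel F M2" for x y
        using that trans sym t_final unfolding W_def by blast
      have M1_W: "y \<in> W" if xy: "x \<in> W" "(x, y) \<in> rel F M1" "y \<noteq> t" for x y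
      proof -
        obtain v where v: "(w, v) \<in> rel F M1" "(v, x) \<in> rel F M2"
          using xy(1) unfolding W_def by blast
        then obtain u where "(v, u) \<in> rel F M1" "(u, y) \<in> rel F M2"
          using com xy(2) by blast
        then show ?thesis
          using v(1) trans xy(3) unfolding W_def by blast
      qed
      have M1_sym: "(y, x) \<in> rel F M1" if xy: "x \<in> W" "(x, y) \<in> rel F M1" "y \<noteq> t" for x y
      proof -
        obtain s where s: "\<And>u. (x, u) \<in> rel F M1 \<Longrightarrow> u \<noteq> s \<Longrightarrow> (u, x) \<in> rel F M1"
          using top W_sub xy(1) by blast
        \<comment> \<open>If \<open>t\<close> differed from the final point \<open>s\<close>
          belonging to \<open>x\<close>, then \<open>t\<close> would see \<open>x\<close>, which
          finality excludes.\<close>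
        have "t = s"
          using s[OF M1_t[OF xy(1)]] t_final xy(1) unfolding W_def by blast
        then show ?thesis using s xy(2,3) by blast
      qed
      have equiv: "equiv W (rel F i \<inter> W \<times> W)" for i
      proof (rule equivI)
        show "rel F i \<inter> W \<times> W \<subseteq> W \<times> W" by blast
        show "refl_on W (rel F i \<inter> W \<times> W)"
          using refl W_sub unfolding refl_on_def by blast
        show "sym (rel F i \<inter> W \<times> W)"
          using sym M1_sym unfolding sym_def W_def by (cases i) blast+
        show "trans (rel F i \<inter> W \<times> W)"
          using trans unfolding trans_def by blast
      qed
      have mid: "\<exists>u \<in> W. (x, u) \<in> rel F M1 \<and> (u, y) \<in> rel F M2" if xy: "x \<in> W" "y \<in> W" for x y
      proof -
        obtain v v' where v: "(w, v) \<in> rel F M1" "(v, x) \<in> rel F M2"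
          and v': "(w, v') \<in> rel F M1" "(v', y) \<in> rel F M2"
          using xy unfolding W_def by blast
        \<comment> \<open>Being different from \<open>t\<close>, \<open>v\<close> returns to
          \<open>w\<close> and so sees \<open>v'\<close>. Commuting the step from \<open>x\<close>
          to \<open>v\<close> with this one gives \<open>u\<close>.\<close>
        have "v \<noteq> t" using v(2) t_final xy(1) unfolding W_def by blast
        then have "(v, v') \<in> rel F M1"
          using w_back v(1) v'(1) trans by blast
        then obtain u where u: "(x, u) \<in> rel F M1" "(u, v') \<in> rel F M2"
          using com sym v(2) by blast
        then have "(u, y) \<in> rel F M2"
          using v'(2) trans by blast
        then show ?thesis
          using u(1) M2_W sym xy(2) by blast
      qed
      have M1_cases: "y = t \<or> y \<in> W" if "x \<in> W" "(x, y) \<in> rel F M1" for x y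
        using that M1_W by blast
      have "\<exists>V' a b. tack_sat V' (Some (a, b)) \<phi> \<longleftrightarrow> sat F V w \<phi>"
        by (rule tack_model_exists[where W = W and t = t])
          (fact W_sub wW t(1) t_rel M1_cases M1_t M2_W equiv mid)+
      then show ?thesis
        using \<phi> unfolding in_Tack2_iff by blast
    qed
  qed
  then show "\<phi> \<in> logic_of F"
    by (simp add: logic_of_def valid_def)
qed

section \<open>The canonical frame of the axiomatised logic\<close>

lemma normal_tack_logic: "normal_logic tack_logic"
  unfolding tack_logic_def by (rule least_normal_normal)

interpretation tack: normal_logic tack_logic
  by (rule normal_tack_logic)

abbreviation mcs :: "modality fm set \<Rightarrow> bool" where
  "mcs \<equiv> max_consistent tack_logic"

lemma commutator_subset_tack_logic: "commutator S4_B2 S5 \<subseteq> tack_logic"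
  unfolding tack_logic_def by (rule order.trans[OF Un_upper1 least_normal_superset])

lemma S4_B2_subset_tack_logic: "map_fm (\<lambda>_. M1) ` S4_B2 \<subseteq> tack_logic"
  and S5_subset_tack_logic: "map_fm (\<lambda>_. M2) ` S5 \<subseteq> tack_logic"
  and com_subset_tack_logic:
    "{Imp (Dia M1 (Dia M2 (Var 0))) (Dia M2 (Dia M1 (Var 0))),
      Imp (Dia M2 (Dia M1 (Var 0))) (Dia M1 (Dia M2 (Var 0))),
      Imp (Dia M1 (Box M2 (Var 0))) (Box M2 (Dia M1 (Var 0)))} \<subseteq> tack_logic"
  using order.trans[OF least_normal_superset commutator_subset_tack_logic[unfolded commutator_def]]
  by (simp_all only: Un_subset_iff)

lemma S4_subset_tack_logic: "map_fm (\<lambda>_. i) ` S4 \<subseteq> tack_logic"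
proof (cases i)
  case M1
  have "S4 \<subseteq> S4_B2"
    unfolding S4_B2_def by (rule order.trans[OF Un_upper1 least_normal_superset])
  then show ?thesis using M1 S4_B2_subset_tack_logic by blast
next
  case M2
  have "S4 \<subseteq> S5"
    unfolding S5_def by (rule order.trans[OF Un_upper1 least_normal_superset])
  then show ?thesis using M2 S5_subset_tack_logic by blast
qed

lemma tack_logic_instances:
  shows "Imp (Dia i (Dia i \<phi>)) (Dia i \<phi>) \<in> tack_logic"
    and "Imp \<phi> (Dia i \<phi>) \<in> tack_logic"
    and "Imp \<phi> (Box M2 (Dia M2 \<phi>)) \<in> tack_logic"
    and "Imp (Dia M1 (Dia M2 \<phi>)) (Dia M2 (Dia M1 \<phi>)) \<in> tack_logic"
    and "Imp (Dia M2 (Dia M1 \<phi>)) (Dia M1 (Dia M2 \<phi>)) \<in> tack_logic"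
    and "Imp (Dia M1 (Dia M2 (Box M1 (Box M2 \<phi>)))) (Box M1 (Box M2 (Dia M1 (Dia M2 \<phi>))))
      \<in> tack_logic"
    and "Imp (Box M1 (Box M2 (Dia M1 (Dia M2 \<phi>)))) (Dia M1 (Dia M2 (Box M1 (Box M2 \<phi>))))
      \<in> tack_logic"
    and "Imp (And (And (Dia M1 (Box M1 \<psi>)) (Neg \<psi>)) \<phi>) (Box M1 (Imp (Neg \<psi>) (Dia M1 \<phi>)))
      \<in> tack_logic"
proof -
  let ?\<sigma> = "\<lambda>n::nat. if n = 0 then \<phi> else \<psi>"
  have inst: "subst ?\<sigma> \<chi> \<in> tack_logic" if "\<chi> \<in> tack_logic" for \<chi>
    using that by (rule tack.substitution)
  have S4: "Imp (Dia () (Dia () (Var 0))) (Dia () (Var 0)) \<in> S4" "Imp (Var 0) (Dia () (Var 0)) \<in> S4"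
    unfolding S4_def by (rule subsetD[OF least_normal_superset], simp)+
  show "Imp (Dia i (Dia i \<phi>)) (Dia i \<phi>) \<in> tack_logic"
    using inst[OF subsetD[OF S4_subset_tack_logic imageI[OF S4(1)]], of i] by simp
  show "Imp \<phi> (Dia i \<phi>) \<in> tack_logic"
    using inst[OF subsetD[OF S4_subset_tack_logic imageI[OF S4(2)]], of i] by simp
  have S5: "Imp (Var 0) (Box () (Dia () (Var 0))) \<in> S5"
    unfolding S5_def by (rule subsetD[OF least_normal_superset]) simp
  show "Imp \<phi> (Box M2 (Dia M2 \<phi>)) \<in> tack_logic"
    using inst[OF subsetD[OF S5_subset_tack_logic imageI[OF S5]]] by simp
  have "Imp (Dia M1 (Dia M2 (Var 0))) (Dia M2 (Dia M1 (Var 0))) \<in> tack_logic"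
    "Imp (Dia M2 (Dia M1 (Var 0))) (Dia M1 (Dia M2 (Var 0))) \<in> tack_logic"
    using com_subset_tack_logic by simp_all
  from this[THEN inst]
  show "Imp (Dia M1 (Dia M2 \<phi>)) (Dia M2 (Dia M1 \<phi>)) \<in> tack_logic"
    "Imp (Dia M2 (Dia M1 \<phi>)) (Dia M1 (Dia M2 \<phi>)) \<in> tack_logic"
    by simp_all
  have "Imp (Dia M1 (Dia M2 (Box M1 (Box M2 (Var 0))))) (Box M1 (Box M2 (Dia M1 (Dia M2 (Var 0)))))
      \<in> tack_logic"
    "Imp (Box M1 (Box M2 (Dia M1 (Dia M2 (Var 0))))) (Dia M1 (Dia M2 (Box M1 (Box M2 (Var 0)))))
      \<in> tack_logic"
    "Imp (And (And (Dia M1 (Box M1 (Var 1))) (Neg (Var 1))) (Var 0))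
      (Box M1 (Imp (Neg (Var 1)) (Dia M1 (Var 0)))) \<in> tack_logic"
    unfolding tack_logic_def by (rule subsetD[OF least_normal_superset], simp)+
  from this[THEN inst]
  show "Imp (Dia M1 (Dia M2 (Box M1 (Box M2 \<phi>)))) (Box M1 (Box M2 (Dia M1 (Dia M2 \<phi>))))
      \<in> tack_logic"
    "Imp (Box M1 (Box M2 (Dia M1 (Dia M2 \<phi>)))) (Dia M1 (Dia M2 (Box M1 (Box M2 \<phi>))))
      \<in> tack_logic"
    "Imp (And (And (Dia M1 (Box M1 \<psi>)) (Neg \<psi>)) \<phi>) (Box M1 (Imp (Neg \<psi>) (Dia M1 \<phi>)))
      \<in> tack_logic"
    by simp_all
qed

section \<open>Frame conditions from S4, S5 and commutation\<close>

lemma can_refl: "mcs \<Gamma> \<Longrightarrow> tack.can_rel \<Gamma> i \<Gamma>"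
  unfolding tack.can_rel_iff using tack.max_consistent_mp tack_logic_instances(2) by blast

lemma can_trans: "tack.can_rel \<Gamma> i \<Delta> \<Longrightarrow> tack.can_rel \<Delta> i \<Theta> \<Longrightarrow> tack.can_rel \<Gamma> i \<Theta>"
  unfolding tack.can_rel_iff using tack.max_consistent_mp tack_logic_instances(1) by blast

lemma can_sym:
  assumes "tack.can_rel \<Gamma> M2 \<Delta>"
  shows "tack.can_rel \<Delta> M2 \<Gamma>"
proof -
  have "Dia M2 \<phi> \<in> \<Delta>" if "\<phi> \<in> \<Gamma>" for \<phi>
    using that assms tack.max_consistent_mp[OF _ tack_logic_instances(3)] tack.can_rel_Box[OF assms]
    unfolding tack.can_rel_iff by blast
  then show ?thesis using assms unfolding tack.can_rel_iff by blast
qed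

lemma can_commute:
  "rel (canonical_frame tack_logic) M1 O rel (canonical_frame tack_logic) M2 =
   rel (canonical_frame tack_logic) M2 O rel (canonical_frame tack_logic) M1"
proof -
  have swap: "\<exists>\<Delta>'. tack.can_rel \<Gamma> j \<Delta>' \<and> tack.can_rel \<Delta>' i \<Theta>"
    if rels: "tack.can_rel \<Gamma> i \<Delta>" "tack.can_rel \<Delta> j \<Theta>"
      and com: "\<And>\<phi>. Imp (Dia i (Dia j \<phi>)) (Dia j (Dia i \<phi>)) \<in> tack_logic" for \<Gamma> \<Delta> \<Theta> i j
  proof -
    have "Dia j (Dia i \<phi>) \<in> \<Gamma>" if "\<phi> \<in> \<Theta>" for \<phi>
      using that rels tack.max_consistent_mp[OF _ com]
      unfolding tack.can_rel_iff by blast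
    moreover have "mcs \<Gamma>" "mcs \<Theta>"
      using rels unfolding tack.can_rel_iff by blast+
    ultimately obtain \<Delta>' where "tack.can_rel \<Gamma> j \<Delta>'" "tack.can_rel \<Delta>' i \<Theta>"
      using tack.can_rel_compose by metis
    then show ?thesis by blast
  qed
  show ?thesis
  proof (intro equalityI subsetI)
    fix p assume "p \<in> rel (canonical_frame tack_logic) M1 O rel (canonical_frame tack_logic) M2"
    then obtain \<Gamma> \<Delta> \<Theta> where "p = (\<Gamma>, \<Theta>)" "tack.can_rel \<Gamma> M1 \<Delta>" "tack.can_rel \<Delta> M2 \<Theta>"
      by (auto elim: relcompE)
    then show "p \<in> rel (canonical_frame tack_logic) M2 O rel (canonical_frame tack_logic) M1"
      using swap[of \<Gamma> \<Delta> M1 \<Theta> M2] tack_logic_instances(4) by auto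
  next
    fix p assume "p \<in> rel (canonical_frame tack_logic) M2 O rel (canonical_frame tack_logic) M1"
    then obtain \<Gamma> \<Delta> \<Theta> where "p = (\<Gamma>, \<Theta>)" "tack.can_rel \<Gamma> M2 \<Delta>" "tack.can_rel \<Delta> M1 \<Theta>"
      by (auto elim: relcompE)
    then show "p \<in> rel (canonical_frame tack_logic) M1 O rel (canonical_frame tack_logic) M2"
      using swap[of \<Gamma> \<Delta> M2 \<Theta> M1] tack_logic_instances(5) by auto
  qed
qed

section \<open>The compound modality and final points\<close>

definition can_reach :: "modality fm set \<Rightarrow> modality fm set \<Rightarrow> bool" where
  "can_reach \<Gamma> \<Theta> \<longleftrightarrow> (\<exists>\<Delta>. tack.can_rel \<Gamma> M1 \<Delta> \<and> tack.can_rel \<Delta> M2 \<Theta>)"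

lemma can_reach_mcs: "can_reach \<Gamma> \<Delta> \<Longrightarrow> mcs \<Gamma> \<and> mcs \<Delta>"
  unfolding can_reach_def tack.can_rel_iff by blast

lemma can_reach_refl: "mcs \<Gamma> \<Longrightarrow> can_reach \<Gamma> \<Gamma>"
  unfolding can_reach_def using can_refl by blast

text \<open>Commutation swaps the two inner steps, after which transitivity merges steps of the same
  kind. The compound diamond is thus an S4 diamond.\<close>

lemma can_reach_trans: "can_reach \<Gamma> \<Delta> \<Longrightarrow> can_reach \<Delta> \<Theta> \<Longrightarrow> can_reach \<Gamma> \<Theta>"
  unfolding can_reach_def using can_trans can_commute by blast

lemma Dia_Dia_iff:
  assumes "mcs \<Gamma>"
  shows "Dia M1 (Dia M2 \<phi>) \<in> \<Gamma> \<longleftrightarrow> (\<exists>\<Delta>. can_reach \<Gamma> \<Delta> \<and> \<phi> \<in> \<Delta>)"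
proof
  assume "Dia M1 (Dia M2 \<phi>) \<in> \<Gamma>"
  then obtain \<Theta> where \<Theta>: "tack.can_rel \<Gamma> M1 \<Theta>" "Dia M2 \<phi> \<in> \<Theta>"
    using assms tack.existence by blast
  then obtain \<Delta> where "tack.can_rel \<Theta> M2 \<Delta>" "\<phi> \<in> \<Delta>"
    using tack.existence tack.can_rel_iff by blast
  then show "\<exists>\<Delta>. can_reach \<Gamma> \<Delta> \<and> \<phi> \<in> \<Delta>"
    using \<Theta>(1) unfolding can_reach_def by blast
next
  assume "\<exists>\<Delta>. can_reach \<Gamma> \<Delta> \<and> \<phi> \<in> \<Delta>"
  then show "Dia M1 (Dia M2 \<phi>) \<in> \<Gamma>"
    unfolding can_reach_def tack.can_rel_iff by blast
qed

lemma Box_iff: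
  assumes "mcs \<Gamma>"
  shows "Box i \<phi> \<in> \<Gamma> \<longleftrightarrow> (\<forall>\<Delta>. tack.can_rel \<Gamma> i \<Delta> \<longrightarrow> \<phi> \<in> \<Delta>)"
proof
  show "\<forall>\<Delta>. tack.can_rel \<Gamma> i \<Delta> \<longrightarrow> \<phi> \<in> \<Delta>" if "Box i \<phi> \<in> \<Gamma>"
    using that tack.can_rel_Box by blast
  show "Box i \<phi> \<in> \<Gamma>" if *: "\<forall>\<Delta>. tack.can_rel \<Gamma> i \<Delta> \<longrightarrow> \<phi> \<in> \<Delta>"
  proof (rule ccontr)
    assume "Box i \<phi> \<notin> \<Gamma>"
    then have "Dia i (Neg \<phi>) \<in> \<Gamma>"
      using assms tack.max_consistent_Neg by blast
    then obtain \<Delta> where "tack.can_rel \<Gamma> i \<Delta>" "Neg \<phi> \<in> \<Delta>"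
      using assms tack.existence by blast
    then show False
      using * tack.can_rel_iff tack.max_consistent_Neg by blast
  qed
qed

lemma Box_Box_iff:
  assumes "mcs \<Gamma>"
  shows "Box M1 (Box M2 \<phi>) \<in> \<Gamma> \<longleftrightarrow> (\<forall>\<Delta>. can_reach \<Gamma> \<Delta> \<longrightarrow> \<phi> \<in> \<Delta>)"
  unfolding Box_iff[OF assms] can_reach_def using Box_iff tack.can_rel_iff by blast

text \<open>
  The two McKinsey-type axioms identify \<open>\<diamond>\<box>\<close> with \<open>\<box>\<diamond>\<close>, where \<open>\<diamond> = \<diamond>\<^sub>1\<diamond>\<^sub>2\<close>; hence the
  formulas \<open>\<phi>\<close> with \<open>\<diamond>\<box>\<phi> \<in> \<Gamma>\<close> form a maximal consistent set, the final point above \<open>\<Gamma>\<close>.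
\<close>

lemma final_point_exists:
  assumes \<Gamma>: "mcs \<Gamma>"
  obtains t where "can_reach \<Gamma> t" "\<And>\<Delta>. can_reach t \<Delta> \<Longrightarrow> \<Delta> = t"
proof -
  define t where "t = {\<phi>. Dia M1 (Dia M2 (Box M1 (Box M2 \<phi>))) \<in> \<Gamma>}"
  \<comment> \<open>Membership in \<open>t\<close> gets two readings: \<open>ex\<close> as
    diamond-box by definition, and \<open>all\<close> below as box-diamond by the two axioms. Each
    closure property uses whichever reading suits it.\<close>
  have ex: "\<phi> \<in> t \<longleftrightarrow> (\<exists>\<Delta>. can_reach \<Gamma> \<Delta> \<and> (\<forall>\<Theta>. can_reach \<Delta> \<Theta> \<longrightarrow> \<phi> \<in> \<Theta>))" for \<phi>
    unfolding t_def using Dia_Dia_iff[OF \<Gamma>] Box_Box_iff can_reach_mcs by blast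
  have "\<phi> \<in> t \<longleftrightarrow> Box M1 (Box M2 (Dia M1 (Dia M2 \<phi>))) \<in> \<Gamma>" for \<phi>
    unfolding t_def using tack.max_consistent_mp[OF \<Gamma>] tack_logic_instances(6,7) by blast
  then have all: "\<phi> \<in> t \<longleftrightarrow> (\<forall>\<Delta>. can_reach \<Gamma> \<Delta> \<longrightarrow> (\<exists>\<Theta>. can_reach \<Delta> \<Theta> \<and> \<phi> \<in> \<Theta>))" for \<phi>
    unfolding Box_Box_iff[OF \<Gamma>] using Dia_Dia_iff can_reach_mcs by metis
  have box: "Box M1 (Box M2 \<phi>) \<in> t" if \<phi>: "\<phi> \<in> t" for \<phi>
  proof -
    obtain \<Delta> where \<Delta>: "can_reach \<Gamma> \<Delta>" "\<forall>\<Theta>. can_reach \<Delta> \<Theta> \<longrightarrow> \<phi> \<in> \<Theta>"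
      using \<phi> ex by blast
    have "Box M1 (Box M2 \<phi>) \<in> \<Theta>" if "can_reach \<Delta> \<Theta>" for \<Theta>
      using that \<Delta>(2) Box_Box_iff can_reach_mcs can_reach_trans by blast
    then show ?thesis unfolding ex using \<Delta>(1) by blast
  qed
  have t: "mcs t"
  proof (rule tack.max_consistentI)
    show "tack_logic \<subseteq> t"
    proof
      fix \<phi> assume "\<phi> \<in> tack_logic"
      then show "\<phi> \<in> t"
        unfolding ex using can_reach_refl[OF \<Gamma>] can_reach_mcs tack.max_consistent_theorem by blast
    qed
    show "Bot \<notin> t"
      unfolding all using can_reach_refl[OF \<Gamma>] can_reach_mcs tack.max_consistent_Bot by blast
    show "\<phi> \<in> t \<or> Neg \<phi> \<in> t" for \<phi>
    proof (rule ccontr)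
      assume n: "\<not> (\<phi> \<in> t \<or> Neg \<phi> \<in> t)"
      \<comment> \<open>Failure of box-diamond for \<phi> is diamond-box for its negation.\<close>
      then obtain \<Delta> where \<Delta>: "can_reach \<Gamma> \<Delta>" "\<forall>\<Theta>. can_reach \<Delta> \<Theta> \<longrightarrow> \<phi> \<notin> \<Theta>"
        unfolding all by blast
      then have "\<forall>\<Theta>. can_reach \<Delta> \<Theta> \<longrightarrow> Neg \<phi> \<in> \<Theta>"
        using can_reach_mcs tack.max_consistent_Neg by blast
      then show False
        using n \<Delta>(1) ex by blast
    qed
    show "\<psi> \<in> t" if \<phi>: "\<phi> \<in> t" and imp: "Imp \<phi> \<psi> \<in> t" for \<phi> \<psi>
      unfolding all
    proof (intro allI impI)
      fix \<Delta> assume \<Delta>: "can_reach \<Gamma> \<Delta>"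
      \<comment> \<open>First a point above which \<phi> holds everywhere is reached, then above it
        a point with the implication; both formulas hold there.\<close>
      obtain \<Theta> where \<Theta>: "can_reach \<Delta> \<Theta>" "Box M1 (Box M2 \<phi>) \<in> \<Theta>"
        using box[OF \<phi>] \<Delta> unfolding all by blast
      then obtain \<Lambda> where \<Lambda>: "can_reach \<Theta> \<Lambda>" "Imp \<phi> \<psi> \<in> \<Lambda>"
        using imp \<Delta> can_reach_trans unfolding all by blast
      have "\<phi> \<in> \<Lambda>"
        using \<Theta>(2) \<Lambda>(1) Box_Box_iff can_reach_mcs by blast
      then have "\<psi> \<in> \<Lambda>"
        using \<Lambda> can_reach_mcs tack.max_consistent_Imp by blast
      then show "\<exists>\<Theta>. can_reach \<Delta> \<Theta> \<and> \<psi> \<in> \<Theta>"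
        using \<Theta>(1) \<Lambda>(1) can_reach_trans by blast
    qed
  qed
  show thesis
  proof
    \<comment> \<open>The point witnessing diamond-box reaches itself, so \<phi> holds there;
      \<open>can_rel_compose\<close> then makes \<open>t\<close> itself reachable.\<close>
    have "Dia M1 (Dia M2 \<phi>) \<in> \<Gamma>" if "\<phi> \<in> t" for \<phi>
      using that can_reach_refl can_reach_mcs unfolding Dia_Dia_iff[OF \<Gamma>] ex by blast
    then obtain \<Theta> where "tack.can_rel \<Gamma> M1 \<Theta>" "tack.can_rel \<Theta> M2 t"
      using tack.can_rel_compose[OF \<Gamma> t] by blast
    then show "can_reach \<Gamma> t" unfolding can_reach_def by blast
    show "\<Delta> = t" if "can_reach t \<Delta>" for \<Delta>
    proof -
      have "t \<subseteq> \<Delta>"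
        using that box Box_Box_iff[OF t] by blast
      then show ?thesis
        using that t can_reach_mcs tack.max_consistent_eqI by blast
    qed
  qed
qed

lemma tack_like_canonical_frame: "tack_like (canonical_frame tack_logic)"
  unfolding tack_like_def
proof (intro conjI allI ballI)
  show "rel (canonical_frame tack_logic) i \<subseteq>
      worlds (canonical_frame tack_logic) \<times> worlds (canonical_frame tack_logic)" for i
    by (auto simp: tack.can_rel_iff tack.worlds_canonical)
  show "refl_on (worlds (canonical_frame tack_logic)) (rel (canonical_frame tack_logic) i)" for i
    unfolding refl_on_def using can_refl tack.worlds_canonical by blast
  show "trans (rel (canonical_frame tack_logic) i)" for i
    unfolding trans_def using can_trans by blast
  show "sym (rel (canonical_frame tack_logic) M2)"
    unfolding sym_def using can_sym by blast
  show "rel (canonical_frame tack_logic) M1 O rel (canonical_frame tack_logic) M2 =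
      rel (canonical_frame tack_logic) M2 O rel (canonical_frame tack_logic) M1"
    by (rule can_commute)
  fix \<Gamma> assume "\<Gamma> \<in> worlds (canonical_frame tack_logic)"
  then have \<Gamma>: "mcs \<Gamma>" by (simp add: tack.worlds_canonical)
  obtain t where reach: "can_reach \<Gamma> t" and final: "\<And>\<Delta>. can_reach t \<Delta> \<Longrightarrow> \<Delta> = t"
    using final_point_exists[OF \<Gamma>] by blast
  have t: "mcs t" using reach can_reach_mcs by blast
  have t_rel: "\<Delta> = t" if "tack.can_rel t i \<Delta>" for i \<Delta>
  proof -
    have "can_reach t \<Delta>"
      using that can_refl tack.can_rel_iff unfolding can_reach_def by (cases i) blast+
    then show ?thesis by (rule final)
  qed
  \<comment> \<open>The second step into \<open>t\<close> can be reversed, so by finality its source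
    is already \<open>t\<close>.\<close>
  have \<Gamma>t: "tack.can_rel \<Gamma> M1 t"
    using reach can_sym t_rel unfolding can_reach_def by blast
  have M1_sym: "tack.can_rel \<Delta> M1 \<Gamma>" if \<Delta>: "tack.can_rel \<Gamma> M1 \<Delta>" "\<Delta> \<noteq> t" for \<Delta>
  proof (rule ccontr)
    assume "\<not> tack.can_rel \<Delta> M1 \<Gamma>"
    have mcs_\<Delta>: "mcs \<Delta>" using \<Delta>(1) tack.can_rel_iff by blast
    obtain p where p: "p \<in> \<Gamma>" "Dia M1 p \<notin> \<Delta>"
      using \<open>\<not> tack.can_rel \<Delta> M1 \<Gamma>\<close> \<Gamma> mcs_\<Delta> unfolding tack.can_rel_iff by blast
    have "\<Gamma> \<noteq> t" using \<Delta> t_rel by blast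
    then obtain q1 where q1: "q1 \<in> t" "q1 \<notin> \<Gamma>"
      using tack.max_consistent_eqI[OF t \<Gamma>] by blast
    obtain q2 where q2: "q2 \<in> t" "q2 \<notin> \<Delta>"
      using tack.max_consistent_eqI[OF t mcs_\<Delta>] \<Delta>(2) by blast
    \<comment> \<open>The formula \<open>q\<close> holds at \<open>t\<close> but neither at \<Gamma>
      nor at \<Delta>, so it separates the top from both. At \<Gamma> it satisfies the premise of
      the last axiom together with \<open>p\<close>, and the conclusion forces
      \<open>Dia M1 p\<close> into \<Delta>.\<close>
    define q where "q = And q1 q2"
    have q: "q \<in> t" "q \<notin> \<Gamma>" "q \<notin> \<Delta>"
      using q1 q2 t \<Gamma> mcs_\<Delta>
      by (simp_all add: q_def tack.max_consistent_Imp tack.max_consistent_Bot)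
    have "Box M1 q \<in> t"
      unfolding Box_iff[OF t] using t_rel q(1) by blast
    then have "Dia M1 (Box M1 q) \<in> \<Gamma>"
      using \<Gamma>t tack.can_rel_iff by blast
    then have "And (And (Dia M1 (Box M1 q)) (Neg q)) p \<in> \<Gamma>"
      using q(2) p(1) by (simp add: tack.max_consistent_Imp[OF \<Gamma>] tack.max_consistent_Bot[OF \<Gamma>])
    then have "Box M1 (Imp (Neg q) (Dia M1 p)) \<in> \<Gamma>"
      by (rule tack.max_consistent_mp[OF \<Gamma> tack_logic_instances(8)])
    then have "Imp (Neg q) (Dia M1 p) \<in> \<Delta>"
      by (rule tack.can_rel_Box[OF \<Delta>(1)])
    then show False
      using q(3) p(2) mcs_\<Delta> by (simp add: tack.max_consistent_Imp tack.max_consistent_Bot)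
  qed
  show "\<exists>t \<in> worlds (canonical_frame tack_logic). tack.can_rel \<Gamma> M1 t \<and>
      (\<forall>i u. tack.can_rel t i u \<longrightarrow> u = t) \<and>
      (\<forall>u. tack.can_rel \<Gamma> M1 u \<longrightarrow> u \<noteq> t \<longrightarrow> tack.can_rel u M1 \<Gamma>)"
    using t \<Gamma>t t_rel M1_sym tack.worlds_canonical by blast
qed

theorem theorem6p14:
  shows "Tack2 = least_normal (commutator S4_B2 S5 \<union>
           {Imp (Dia M1 (Dia M2 (Box M1 (Box M2 (Var 0))))) (Box M1 (Box M2 (Dia M1 (Dia M2 (Var 0))))),
            Imp (Box M1 (Box M2 (Dia M1 (Dia M2 (Var 0))))) (Dia M1 (Dia M2 (Box M1 (Box M2 (Var 0))))),
            Imp (And (And (Dia M1 (Box M1 (Var 1))) (Neg (Var 1))) (Var 0))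
                (Box M1 (Imp (Neg (Var 1)) (Dia M1 (Var 0))))})
         \<and> canonical Tack2"
proof -
  have complete: "Tack2 \<subseteq> logic_of (canonical_frame tack_logic)"
    by (rule Tack2_subset_logic_of[OF tack_like_canonical_frame])
  \<comment> \<open>The inclusions close a cycle through the logic of the canonical frame. Once the
    two logics coincide, \<open>complete\<close> is canonicity.\<close>
  then have "Tack2 = tack_logic"
    using tack.logic_of_canonical_frame_subset tack_logic_subset_Tack2 by blast
  moreover from this have "canonical Tack2"
    using complete by (auto simp: canonical_def logic_of_def)
  ultimately show ?thesis
    unfolding tack_logic_def by blast
qed

end
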